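(* Let $(E,d)$ be a Polish space, $\mu$ a probability measure on $(E,\mathcal{B}(E))$, $\mathcal{F}$ a stable class of closed subsets of $E$ equipped with a metric $d_{\mathcal{F}}$, and $\tau:\mathcal{F}\to[0,\infty]$ a size function, such that $\tau^\beta<\infty$ for any $0<\beta<1$. Let $(X_n)_{n\geq1}$ be independent random variables with the same law $\mu$ and let $\mu_n=\frac1n\sum_{1\leq i\leq n}\delta_{X_i}$ be the empirical measure. Let $0<\alpha<1$. Suppose that: (a) the mapping $\beta\mapsto\tau^\beta$ is continuous at $\alpha$; (b) for every sequence $(A_n)_{n\geq1}\subset\mathcal{F}$ such that $\tau(\lim_n A_n)<\infty$: if $\lim_n\tau(A_n)=\tau(\lim_n A_n)$, then $d_{\mathcal{F}}(A_n,\lim_k A_k)\to0$. Then, almost surely, $\mathrm{Haus}(\mathcal{S}_n^\alpha|\mathcal{S}^\alpha)\to0$ as $n\to\infty$, where $\mathcal{S}_n^\alpha=\arg\min\{\tau(A):A\in\mathcal{F},\ \mu_n(A)\geq1-\alpha\}$, $\mathcal{S}^\alpha=\arg\min\{\tau(A):A\in\mathcal{F},\ \mu(A)\geq1-\alpha\}$, and the Hausdorff contrast between these subsets of $\mathcal{F}$ is taken with respect to $d_{\mathcal{F}}$.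
   Context: For $B$ a subset of a metric space and $\varepsilon>0$, $B^\varepsilon$ is the set of points at distance $<\varepsilon$ from some point of $B$. For a sequence $(B_n)_{n\geq1}$ of closed subsets of $E$, $\lim_n B_n:=\bigcap_{\varepsilon>0}\bigcup_{k\geq1}\bigcap_{n\geq k}B_n^\varepsilon$. A class $\mathcal{F}$ of closed subsets of $E$ is stable if $E\in\mathcal{F}$ and every sequence $(B_n)_{n\geq1}\subset\mathcal{F}$ admits indices $(n_k)_{k\geq1}$, $n_k\to\infty$, with $\lim_k B_{n_k}\in\mathcal{F}$. Hausdorff contrast between two subsets $A,B$ of a metric space: $\mathrm{Haus}(A|B):=\inf\{\varepsilon>0: A\subset B^\varepsilon\}$. Size function: a map $\tau:\mathcal{F}\to[0,\infty]$ such that (i) $A\subset B\Rightarrow\tau(A)\leq\tau(B)$; (ii) for every decreasing sequence $(A_n)_{n\geq1}\subset\mathcal{F}$ with $\tau(A_1)<\infty$ and $\mathrm{Haus}(A_n|\bigcap_k A_k)\to0$, one has $\tau(A_n)\to\tau(\bigcap_n A_n)$; (iii) for every sequence $(A_n)_{n\geq1}\subset\mathcal{F}$, $\tau(\lim_n A_n)\leq\liminf_n\tau(A_n)$. By convention, statements involving $\tau$ (or $d_{\mathcal{F}}$) of a limit set or of an intersection refer to the situation where that set belongs to $\mathcal{F}$. For $0<\beta<1$, $\tau^\beta:=\inf\{\tau(A):A\in\mathcal{F},\ \mu(A)\geq1-\beta\}$. *)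

theory Defs
  imports "HOL-Probability.Probability"
begin

text \<open>The set of points of the metric space \<open>(M, d)\<close> at distance \<open>< \<epsilon>\<close> from some point of \<open>B\<close>.
  The space is given by an explicit carrier because the notion is needed both for the ambient
  type-class space, as \<open>(UNIV, dist)\<close>, and for a class of sets with its own metric.\<close>

definition nbhd :: "'b set \<Rightarrow> ('b \<Rightarrow> 'b \<Rightarrow> real) \<Rightarrow> 'b set \<Rightarrow> real \<Rightarrow> 'b set" where
  "nbhd M d B \<epsilon> = {x \<in> M. \<exists>y\<in>B. d x y < \<epsilon>}"

text \<open>Valued in \<^typ>\<open>ennreal\<close>, so that the infimum of the empty set is \<open>\<infinity>\<close>.\<close>

definition haus_contrast :: "'b set \<Rightarrow> ('b \<Rightarrow> 'b \<Rightarrow> real) \<Rightarrow> 'b set \<Rightarrow> 'b set \<Rightarrow> ennreal" where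
  "haus_contrast M d A B = (INF \<epsilon>\<in>{\<epsilon>. 0 < \<epsilon> \<and> A \<subseteq> nbhd M d B \<epsilon>}. ennreal \<epsilon>)"

definition set_lim :: "(nat \<Rightarrow> 'a::metric_space set) \<Rightarrow> 'a set" where
  "set_lim B = (\<Inter>\<epsilon>\<in>{0<..}. \<Union>k. \<Inter>n\<in>{k..}. nbhd UNIV dist (B n) \<epsilon>)"

text \<open>The indices are only required to tend to infinity, not to be increasing.\<close>

definition stable_class :: "'a::metric_space set set \<Rightarrow> bool" where
  "stable_class \<F> \<longleftrightarrow>
     (\<forall>A\<in>\<F>. closed A) \<and> UNIV \<in> \<F> \<and>
     (\<forall>B :: nat \<Rightarrow> 'a set. range B \<subseteq> \<F> \<longrightarrow>
        (\<exists>r :: nat \<Rightarrow> nat. filterlim r at_top sequentially \<and> set_lim (\<lambda>k. B (r k)) \<in> \<F>))"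

text \<open>Only the values of \<open>\<tau>\<close> on \<open>\<F>\<close> matter; the last two conditions are accordingly restricted to
  sequences whose intersection or limit belongs to \<open>\<F>\<close>.\<close>

definition size_function :: "'a::metric_space set set \<Rightarrow> ('a set \<Rightarrow> ennreal) \<Rightarrow> bool" where
  "size_function \<F> \<tau> \<longleftrightarrow>
     (\<forall>A\<in>\<F>. \<forall>B\<in>\<F>. A \<subseteq> B \<longrightarrow> \<tau> A \<le> \<tau> B) \<and>
     (\<forall>A :: nat \<Rightarrow> 'a set. range A \<subseteq> \<F> \<and> decseq A \<and> (\<Inter>n. A n) \<in> \<F> \<and> \<tau> (A 0) < \<infinity> \<and>
        (\<lambda>n. haus_contrast UNIV dist (A n) (\<Inter>k. A k)) \<longlonglongrightarrow> 0 \<longrightarrow>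
        (\<lambda>n. \<tau> (A n)) \<longlonglongrightarrow> \<tau> (\<Inter>n. A n)) \<and>
     (\<forall>A :: nat \<Rightarrow> 'a set. range A \<subseteq> \<F> \<and> set_lim A \<in> \<F> \<longrightarrow>
        \<tau> (set_lim A) \<le> liminf (\<lambda>n. \<tau> (A n)))"

definition min_size :: "'a set set \<Rightarrow> ('a set \<Rightarrow> ennreal) \<Rightarrow> 'a measure \<Rightarrow> real \<Rightarrow> ennreal" where
  "min_size \<F> \<tau> \<nu> \<beta> = (INF A\<in>{A\<in>\<F>. 1 - \<beta> \<le> measure \<nu> A}. \<tau> A)"

definition min_sets :: "'a set set \<Rightarrow> ('a set \<Rightarrow> ennreal) \<Rightarrow> 'a measure \<Rightarrow> real \<Rightarrow> 'a set set" where
  "min_sets \<F> \<tau> \<nu> \<beta> = {A. is_arg_min \<tau> (\<lambda>A. A \<in> \<F> \<and> 1 - \<beta> \<le> measure \<nu> A) A}"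

text \<open>The Dirac mass at \<open>x\<close> is \<^term>\<open>return borel x\<close>.\<close>

definition empirical_measure :: "(nat \<Rightarrow> 'a::topological_space) \<Rightarrow> nat \<Rightarrow> 'a measure" where
  "empirical_measure x n =
     measure_of UNIV (sets borel) (\<lambda>A. (\<Sum>i=1..n. emeasure (return borel (x i)) A) / of_nat n)"

lemma sets_empirical_measure [simp, measurable_cong]:
  "sets (empirical_measure x n) = sets borel"
  unfolding empirical_measure_def
  by (metis sets.sets_measure_of_eq space_borel)

lemma space_empirical_measure [simp]: "space (empirical_measure x n) = UNIV"
  by (simp add: empirical_measure_def space_measure_of_conv)

lemma emeasure_empirical_measure:
  assumes "A \<in> sets borel"
  shows "emeasure (empirical_measure x n) A =
    (\<Sum>i=1..n. emeasure (return borel (x i)) A) / of_nat n"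
proof (rule emeasure_measure_of[OF empirical_measure_def])
  show "countably_additive (sets (empirical_measure x n))
     (\<lambda>A. (\<Sum>i=1..n. emeasure (return borel (x i)) A) / of_nat n)"
  proof (rule countably_additiveI)
    fix B :: "nat \<Rightarrow> 'a set"
    assume B: "range B \<subseteq> sets (empirical_measure x n)" "disjoint_family B"
    then have "(\<Sum>k. emeasure (return borel (x i)) (B k)) = emeasure (return borel (x i)) (\<Union>k. B k)"
      for i
      by (intro suminf_emeasure) auto
    then show "(\<Sum>k. (\<Sum>i=1..n. emeasure (return borel (x i)) (B k)) / of_nat n) =
      (\<Sum>i=1..n. emeasure (return borel (x i)) (\<Union>k. B k)) / of_nat n"
      by (simp add: suminf_sum)
  qed
qed (use assms in \<open>auto simp: positive_def\<close>)

lemma prob_space_empirical_measure: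
  assumes "1 \<le> n"
  shows "prob_space (empirical_measure x n)"
proof (rule prob_spaceI)
  have "(of_nat n :: ennreal) \<noteq> 0" "(of_nat n :: ennreal) < top"
    using assms by (auto simp: of_nat_less_top)
  then show "emeasure (empirical_measure x n) (space (empirical_measure x n)) = 1"
    by (simp add: emeasure_empirical_measure ennreal_divide_self del: of_nat_eq_0_iff)
qed

end

theory Submission
  imports Defs "HOL-Library.Diagonal_Subsequence"
begin

text \<open>Almost surely the empirical measures converge on each member of a suitable countable family of
  Borel sets: finite unions of basic open sets, and near-optimal competitors \<open>C j\<close> for levels
  \<open>\<beta> j < \<alpha>\<close> tending to \<open>\<alpha>\<close>. The competitors have empirical mass at least \<open>1 - \<alpha>\<close> eventually, so the
  empirical minimal sizes are asymptotically at most \<open>min_size \<F> \<tau> \<mu> \<alpha>\<close>, by continuity at \<open>\<alpha>\<close>.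
  If empirical minimizers stayed away from the true ones along a subsequence, a further subsequence
  would have a limit in \<open>\<F>\<close> of \<open>\<mu>\<close>-mass at least \<open>1 - \<alpha>\<close>; lower semicontinuity of \<open>\<tau>\<close> then makes this
  limit a true minimizer and the sizes converge to its size, so that (b) gives convergence in \<open>dF\<close>, a
  contradiction.\<close>

section \<open>Almost sure convergence of empirical frequencies\<close>

lemma measure_empirical_measure:
  assumes "1 \<le> n" and "A \<in> sets borel"
  shows "measure (empirical_measure x n) A = (\<Sum>i=1..n. indicator A (x i)) / real n"
proof -
  have "emeasure (empirical_measure x n) A = (\<Sum>i=1..n. ennreal (indicator A (x i))) / ennreal (real n)"
    using assms by (simp add: emeasure_empirical_measure ennreal_indicator ennreal_of_nat_eq_real_of_nat)
  also have "\<dots> = ennreal ((\<Sum>i=1..n. indicator A (x i)) / real n)"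
    using assms by (subst sum_ennreal) (auto intro!: divide_ennreal sum_nonneg)
  finally show ?thesis
    by (simp add: measure_def sum_nonneg)
qed

text \<open>The indicators of \<open>A\<close> at the sample points are independent and bounded, so
  Hoeffding's inequality makes deviations of size \<epsilon> exponentially unlikely. These
  probabilities are summable, and Borel-Cantelli applies.\<close>

lemma AE_empirical_measure_tendsto:
  fixes X :: "nat \<Rightarrow> 'w \<Rightarrow> 'a::topological_space"
  assumes "prob_space P"
    and indep: "prob_space.indep_vars P (\<lambda>_. borel) X {1..}"
    and distr: "\<And>i. 1 \<le> i \<Longrightarrow> distr P borel (X i) = \<mu>"
    and A [measurable]: "A \<in> sets borel"
  shows "AE \<omega> in P. (\<lambda>n. measure (empirical_measure (\<lambda>i. X i \<omega>) n) A) \<longlonglongrightarrow> measure \<mu> A"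
proof -
  interpret prob_space P by fact
  define p where "p = measure \<mu> A"
  define Z where "Z i \<omega> = (indicator A (X i \<omega>) :: real)" for i \<omega>
  have meas [measurable]: "random_variable borel (X i)" if "1 \<le> i" for i
    using indep that unfolding indep_vars_def by auto
  have indepZ: "indep_vars (\<lambda>_. borel) Z {1..n}" for n
    unfolding Z_def by (rule indep_vars_compose2[OF indep_vars_subset[OF indep]]) auto
  have expZ: "expectation (Z i) = p" if "1 \<le> i" for i
  proof -
    have "expectation (Z i) = (\<integral>x. indicator A x \<partial>distr P borel (X i))"
      unfolding Z_def using meas[OF that] by (subst integral_distr) auto
    then show ?thesis
      by (simp add: distr[OF that] p_def flip: distr[OF that])
  qed
  define Bad where "Bad \<epsilon> n = {\<omega> \<in> space P. real n * \<epsilon> \<le> \<bar>(\<Sum>i=1..n. Z i \<omega>) - real n * p\<bar>}"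
    for \<epsilon> :: real and n
  have meas_Bad [measurable]: "Bad \<epsilon> n \<in> events" for \<epsilon> n
  proof -
    have "Z i \<in> borel_measurable P" if "i \<in> {1..n}" for i
      unfolding Z_def using that by (intro measurable_compose[OF meas]) auto
    then have [measurable]: "(\<lambda>\<omega>. \<Sum>i=1..n. Z i \<omega>) \<in> borel_measurable P"
      by (rule borel_measurable_sum)
    show ?thesis unfolding Bad_def by measurable
  qed
  have bound: "prob (Bad \<epsilon> n) \<le> 2 * exp (- 2 * \<epsilon>\<^sup>2) ^ n" if "0 < \<epsilon>" for \<epsilon> n
  proof (cases "n = 0")
    case False
    \<comment> \<open>The indicators have range [0, 1], so the squared lengths of the ranges sum to
      \<open>n\<close>, and the deviation \<open>real n * \<epsilon>\<close> yields the exponent -2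
      n \<epsilon>^2.\<close>
    interpret H: Hoeffding_ineq P "{1..n}" Z "\<lambda>_. 0" "\<lambda>_. 1" "\<Sum>i=1..n. expectation (Z i)"
    proof unfold_locales
      show "indep_vars (\<lambda>_. borel) Z {1..n}"
        by (rule indepZ)
    qed (auto simp: Z_def indicator_def)
    have "(\<Sum>i=1..n. expectation (Z i)) = real n * p"
      by (simp add: expZ)
    then have "prob (Bad \<epsilon> n) \<le> 2 * exp (- 2 * (real n * \<epsilon>)\<^sup>2 / real n)"
      using H.Hoeffding_ineq_abs_ge[of "real n * \<epsilon>"] that False by (simp add: Bad_def)
    also have "- 2 * (real n * \<epsilon>)\<^sup>2 / real n = real n * (- 2 * \<epsilon>\<^sup>2)"
      using False by (simp add: power2_eq_square field_simps)
    finally show ?thesis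
      by (simp only: exp_of_nat_mult)
  \<comment> \<open>For \<open>n = 0\<close> the bound is 2, which no probability exceeds.\<close>
  qed (simp add: order.trans[OF prob_le_1])
  have "AE \<omega> in P. eventually (\<lambda>n. \<omega> \<in> space P - Bad \<epsilon> n) sequentially" if "0 < \<epsilon>" for \<epsilon>
  proof (rule borel_cantelli_AE1)
    show "summable (\<lambda>n. prob (Bad \<epsilon> n))"
      by (rule summable_comparison_test'[OF summable_mult[OF summable_geometric]])
        (use bound[OF that] that in auto)
  qed (auto simp: emeasure_eq_measure)
  \<comment> \<open>The exceptional null set depends on \<epsilon>; restricting to the radii 1/(m+1)
    leaves a countable union of null sets.\<close>
  then have "AE \<omega> in P. \<forall>m::nat. eventually (\<lambda>n. \<omega> \<in> space P - Bad (inverse (Suc m)) n) sequentially"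
    by (subst AE_all_countable) auto
  then show ?thesis
  proof eventually_elim
    case (elim \<omega>)
    show ?case unfolding p_def[symmetric]
    proof (rule tendstoI)
      fix e :: real assume "0 < e"
      then obtain m where m: "inverse (real (Suc m)) < e"
        using reals_Archimedean by blast
      show "\<forall>\<^sub>F n in sequentially. dist (measure (empirical_measure (\<lambda>i. X i \<omega>) n) A) p < e"
        using elim[rule_format, of m] eventually_ge_at_top[of 1]
      proof eventually_elim
        case (elim n)
        have "\<bar>(\<Sum>i=1..n. Z i \<omega>) - real n * p\<bar> < real n * inverse (real (Suc m))"
          using elim by (auto simp: Bad_def)
        then have "\<bar>(\<Sum>i=1..n. Z i \<omega>) - real n * p\<bar> / real n < inverse (real (Suc m))"
          using elim by (subst pos_divide_less_eq) (auto simp: mult.commute)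
        also have "\<bar>(\<Sum>i=1..n. Z i \<omega>) - real n * p\<bar> / real n = \<bar>((\<Sum>i=1..n. Z i \<omega>) - real n * p) / real n\<bar>"
          by simp
        also have "((\<Sum>i=1..n. Z i \<omega>) - real n * p) / real n = (\<Sum>i=1..n. Z i \<omega>) / real n - p"
          using elim by (simp add: field_simps)
        finally show ?case
          using elim m by (simp add: dist_real_def measure_empirical_measure Z_def)
      qed
    qed
  qed
qed

section \<open>Limits of sequences of sets and their mass\<close>

lemma not_in_set_limE:
  assumes "x \<notin> set_lim A"
  obtains \<epsilon> where "0 < \<epsilon>" "\<exists>\<^sub>F n in sequentially. A n \<inter> ball x \<epsilon> = {}"
proof -
  have "\<exists>\<epsilon>>0. \<forall>k. \<exists>n\<ge>k. \<forall>y\<in>A n. \<not> dist x y < \<epsilon>"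
    using assms by (fastforce simp: set_lim_def nbhd_def)
  then obtain \<epsilon> where "0 < \<epsilon>" "\<forall>k. \<exists>n\<ge>k. \<forall>y\<in>A n. \<not> dist x y < \<epsilon>"
    by blast
  moreover from this have "\<exists>\<^sub>F n in sequentially. A n \<inter> ball x \<epsilon> = {}"
    unfolding frequently_sequentially by (fastforce simp: ball_def)
  ultimately show thesis using that by blast
qed

text \<open>Together with \<open>measure_set_lim_ge\<close> this replaces the compactness of the Kuratowski convergence of
  closed sets: along the subsequence the lower limit is also the upper one.\<close>

lemma subseq_eventually_meets_or_misses:
  fixes A :: "nat \<Rightarrow> 'a set"
  assumes "countable \<B>"
  obtains s :: "nat \<Rightarrow> nat" where "strict_mono s"
    "\<And>U. U \<in> \<B> \<Longrightarrow> (\<forall>\<^sub>F n in sequentially. A (s n) \<inter> U = {}) \<or>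
                    (\<forall>\<^sub>F n in sequentially. A (s n) \<inter> U \<noteq> {})"
proof (cases "\<B> = {}")
  case True
  then show thesis using that[of id] by (simp add: strict_mono_id)
next
  case False
  define Q where "Q j s \<longleftrightarrow> (\<forall>\<^sub>F n in sequentially. A (s n) \<inter> from_nat_into \<B> j = {}) \<or>
      (\<forall>\<^sub>F n in sequentially. A (s n) \<inter> from_nat_into \<B> j \<noteq> {})" for j and s :: "nat \<Rightarrow> nat"
  interpret subseqs Q
  proof
    fix j and s :: "nat \<Rightarrow> nat"
    assume "strict_mono s"
    show "\<exists>r. strict_mono r \<and> Q j (s \<circ> r)"
    proof (cases "\<forall>\<^sub>F n in sequentially. A (s n) \<inter> from_nat_into \<B> j \<noteq> {}")
      case True
      then show ?thesis by (intro exI[of _ id]) (simp add: Q_def strict_mono_id)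
    next
      \<comment> \<open>Infinitely many sets miss the member; the subsequence runs through
        these.\<close>
      case False
      then obtain r :: "nat \<Rightarrow> nat" where "strict_mono r" "\<forall>n. \<not> A (s (r n)) \<inter> from_nat_into \<B> j \<noteq> {}"
        using not_eventually_sequentiallyD[OF False] by blast
      then show ?thesis by (intro exI[of _ r]) (simp add: Q_def)
    qed
  qed
  have "Q k diagseq" for k
  proof -
    \<comment> \<open>The diagonal sequence is a subsequence of the \<open>k\<close>-th refinement
      only from index \<open>Suc k\<close> on. The shift is harmless because \<open>Q\<close>
      concerns tails.\<close>
    have "Q k (diagseq \<circ> (+) (Suc k))"
    proof (rule diagseq_holds)
      fix r s :: "nat \<Rightarrow> nat" and n
      assume "strict_mono r" "Q n s"
      then show "Q n (s \<circ> r)"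
        unfolding Q_def o_def
        by (elim disjE) (rule disjI1 disjI2, erule eventually_subseq, assumption)+
    qed
    then show ?thesis
      unfolding Q_def[of k] o_def add.commute[of "Suc k"]
      using eventually_sequentially_seg[of "\<lambda>n. A (diagseq n) \<inter> from_nat_into \<B> k = {}" "Suc k"]
        eventually_sequentially_seg[of "\<lambda>n. A (diagseq n) \<inter> from_nat_into \<B> k \<noteq> {}" "Suc k"]
      by simp
  qed
  then have "(\<forall>\<^sub>F n in sequentially. A (diagseq n) \<inter> U = {}) \<or>
      (\<forall>\<^sub>F n in sequentially. A (diagseq n) \<inter> U \<noteq> {})" if "U \<in> \<B>" for U
    using from_nat_into_surj[OF assms that] unfolding Q_def by fast
  with subseq_diagseq show thesis
    by (rule that)
qed

text \<open>The complement of the limit is covered by the basic open sets that \<open>A n\<close> eventually misses, so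
  convergence of the measures on finite unions of basic sets is enough.\<close>

lemma measure_set_lim_ge:
  fixes A :: "nat \<Rightarrow> 'a::metric_space set"
  assumes "prob_space \<mu>" and sets: "sets \<mu> = sets borel"
    and "countable \<B>" and basis: "topological_basis \<B>"
    and misses: "\<And>U. U \<in> \<B> \<Longrightarrow> (\<forall>\<^sub>F n in sequentially. A n \<inter> U = {}) \<or>
                    (\<forall>\<^sub>F n in sequentially. A n \<inter> U \<noteq> {})"
    and prob: "\<forall>\<^sub>F n in sequentially. prob_space (\<nu> n)"
    and sets_\<nu>: "\<And>n. sets (\<nu> n) = sets borel"
    and conv: "\<And>\<U>. finite \<U> \<Longrightarrow> \<U> \<subseteq> \<B> \<Longrightarrow> (\<lambda>n. measure (\<nu> n) (\<Union>\<U>)) \<longlonglongrightarrow> measure \<mu> (\<Union>\<U>)"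
    and meas: "\<And>n. A n \<in> sets borel" "set_lim A \<in> sets borel"
    and ge: "\<forall>\<^sub>F n in sequentially. c \<le> measure (\<nu> n) (A n)"
  shows "c \<le> measure \<mu> (set_lim A)"
proof -
  interpret prob_space \<mu> by fact
  have space: "space \<mu> = UNIV"
    using sets_eq_imp_space_eq[OF sets] by simp
  define \<E> where "\<E> = {U\<in>\<B>. \<forall>\<^sub>F n in sequentially. A n \<inter> U = {}}"
  have "\<E> \<subseteq> \<B>" and "countable \<E>"
    using \<open>countable \<B>\<close> by (auto simp: \<E>_def)
  have borel: "\<Union>\<U> \<in> sets borel" if "\<U> \<subseteq> \<B>" for \<U>
    using that topological_basis_open[OF basis] by (intro borel_open open_Union) auto
  have cover: "- set_lim A \<subseteq> \<Union>\<E>"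
  proof
    fix x assume "x \<in> - set_lim A"
    then obtain \<epsilon> where \<epsilon>: "0 < \<epsilon>" "\<exists>\<^sub>F n in sequentially. A n \<inter> ball x \<epsilon> = {}"
      by (auto elim: not_in_set_limE)
    obtain U where U: "U \<in> \<B>" "x \<in> U" "U \<subseteq> ball x \<epsilon>"
      using topological_basisE[OF basis open_ball] \<epsilon>(1) centre_in_ball by metis
    have "\<exists>\<^sub>F n in sequentially. A n \<inter> U = {}"
      using \<epsilon>(2) by (rule frequently_elim1) (use U in auto)
    \<comment> \<open>Lying outside the limit only gives infinitely many misses; the dichotomy
      \<open>misses\<close> upgrades them to all large indices.\<close>
    then show "x \<in> \<Union>\<E>"
      using misses[OF U(1)] U by (auto simp: \<E>_def frequently_def)
  qed
  \<comment> \<open>Finitely many members of \<open>\<E>\<close> are missed simultaneously for large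
    \<open>n\<close>. Their union is then disjoint from \<open>A n\<close>, which carries mass at
    least \<open>c\<close>, and the resulting bound passes to the limit.\<close>
  have fin: "measure \<mu> (\<Union>\<U>) \<le> 1 - c" if "finite \<U>" "\<U> \<subseteq> \<E>" for \<U>
  proof -
    have "\<forall>\<^sub>F n in sequentially. \<forall>U\<in>\<U>. A n \<inter> U = {}"
      using that by (subst eventually_ball_finite_distrib) (auto simp: \<E>_def)
    then have "\<forall>\<^sub>F n in sequentially. measure (\<nu> n) (\<Union>\<U>) \<le> 1 - c"
      using prob ge
    proof eventually_elim
      case (elim n)
      interpret N: prob_space "\<nu> n" by fact
      have "A n \<in> sets (\<nu> n)" "\<Union>\<U> \<in> sets (\<nu> n)"
        using meas borel that \<open>\<E> \<subseteq> \<B>\<close> by (auto simp: sets_\<nu>)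
      moreover have "A n \<inter> \<Union>\<U> = {}"
        using elim by auto
      ultimately have "measure (\<nu> n) (A n) + measure (\<nu> n) (\<Union>\<U>) = measure (\<nu> n) (A n \<union> \<Union>\<U>)"
        by (simp add: N.finite_measure_Union)
      also have "\<dots> \<le> 1"
        by (rule N.prob_le_1)
      finally show ?case
        using elim by simp
    qed
    then show ?thesis
      using conv[of \<U>] that \<open>\<E> \<subseteq> \<B>\<close> by (intro tendsto_upperbound) auto
  qed
  \<comment> \<open>Continuity from below extends the bound from finite subfamilies to the countable
    \<open>\<E>\<close>. The empty family is treated apart because it has no enumeration.\<close>
  have "measure \<mu> (\<Union>\<E>) \<le> 1 - c"
  proof (cases "\<E> = {}")
    case True
    then show ?thesis using fin[of "{}"] by simp
  next
    case False
    define V where "V n = \<Union>(from_nat_into \<E> ` {..n})" for n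
    have sub: "from_nat_into \<E> ` {..n} \<subseteq> \<E>" for n
      using from_nat_into[OF False] by auto
    have "(\<Union>n. V n) = \<Union>(range (from_nat_into \<E>))"
      by (auto simp: V_def)
    then have "(\<Union>n. V n) = \<Union>\<E>"
      using False \<open>countable \<E>\<close> by simp
    moreover have "(\<lambda>n. measure \<mu> (V n)) \<longlonglongrightarrow> measure \<mu> (\<Union>n. V n)"
    proof (rule finite_Lim_measure_incseq)
      show "range V \<subseteq> events"
        using borel sub \<open>\<E> \<subseteq> \<B>\<close> unfolding V_def sets by blast
      show "incseq V"
        unfolding V_def incseq_def by (force intro: order_trans)
    qed
    ultimately show ?thesis
      using fin[OF _ sub] by (intro tendsto_upperbound[of _ _ sequentially]) (auto simp: V_def)
  qed
  moreover have "measure \<mu> (- set_lim A) \<le> measure \<mu> (\<Union>\<E>)"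
    using borel \<open>\<E> \<subseteq> \<B>\<close> cover by (intro finite_measure_mono) (auto simp: sets)
  moreover have "measure \<mu> (- set_lim A) = 1 - measure \<mu> (set_lim A)"
    using prob_compl[of "set_lim A"] meas(2) by (simp add: sets space Compl_eq_Diff_UNIV)
  ultimately show ?thesis by simp
qed

section \<open>Size functions and minimizing sets\<close>

lemma size_function_set_lim_le:
  fixes A :: "nat \<Rightarrow> 'a::metric_space set"
  assumes "size_function \<F> \<tau>" "range A \<subseteq> \<F>" "set_lim A \<in> \<F>"
  shows "\<tau> (set_lim A) \<le> liminf (\<lambda>n. \<tau> (A n))"
proof -
  have "\<forall>A :: nat \<Rightarrow> 'a set. range A \<subseteq> \<F> \<and> set_lim A \<in> \<F> \<longrightarrow>
      \<tau> (set_lim A) \<le> liminf (\<lambda>n. \<tau> (A n))"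
    using assms(1) unfolding size_function_def by (elim conjE)
  then show ?thesis
    using assms(2,3) by simp
qed

lemma min_setsD:
  assumes "A \<in> min_sets \<F> \<tau> \<nu> \<beta>"
  shows "A \<in> \<F>" "1 - \<beta> \<le> measure \<nu> A"
    and "\<And>B. B \<in> \<F> \<Longrightarrow> 1 - \<beta> \<le> measure \<nu> B \<Longrightarrow> \<tau> A \<le> \<tau> B"
  using assms by (auto simp: min_sets_def is_arg_min_def not_less)

lemma min_setsI:
  assumes "A \<in> \<F>" "1 - \<beta> \<le> measure \<nu> A" "\<tau> A \<le> min_size \<F> \<tau> \<nu> \<beta>"
  shows "A \<in> min_sets \<F> \<tau> \<nu> \<beta>"
proof -
  have "\<tau> A \<le> \<tau> B" if "B \<in> \<F>" "1 - \<beta> \<le> measure \<nu> B" for B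
    using assms(3) that unfolding min_size_def by (auto intro: order_trans INF_lower)
  then show ?thesis
    using assms by (auto simp: min_sets_def is_arg_min_def not_less)
qed


section \<open>Consistency of the empirical minimizers\<close>

theorem theorem32:
  fixes \<mu> :: "'a::polish_space measure"
    and \<F> :: "'a set set"
    and dF :: "'a set \<Rightarrow> 'a set \<Rightarrow> real"
    and \<tau> :: "'a set \<Rightarrow> ennreal"
    and P :: "'w measure"
    and X :: "nat \<Rightarrow> 'w \<Rightarrow> 'a"
    and \<alpha> :: real
  assumes "prob_space \<mu>" and "sets \<mu> = sets borel"
    and "stable_class \<F>"
    and "Metric_space \<F> dF"
    and "size_function \<F> \<tau>"
    and "\<And>\<beta>. 0 < \<beta> \<Longrightarrow> \<beta> < 1 \<Longrightarrow> min_size \<F> \<tau> \<mu> \<beta> < \<infinity>"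
    and "prob_space P"
    and "prob_space.indep_vars P (\<lambda>_. borel) X {1..}"
    and "\<And>i. 1 \<le> i \<Longrightarrow> distr P borel (X i) = \<mu>"
    and "0 < \<alpha>" and "\<alpha> < 1"
    and "isCont (min_size \<F> \<tau> \<mu>) \<alpha>"
    and "\<And>A :: nat \<Rightarrow> 'a set. range A \<subseteq> \<F> \<Longrightarrow> set_lim A \<in> \<F> \<Longrightarrow> \<tau> (set_lim A) < \<infinity> \<Longrightarrow>
           (\<lambda>n. \<tau> (A n)) \<longlonglongrightarrow> \<tau> (set_lim A) \<Longrightarrow> (\<lambda>n. dF (A n) (set_lim A)) \<longlonglongrightarrow> 0"
  shows "AE \<omega> in P.
    (\<lambda>n. haus_contrast \<F> dF
            (min_sets \<F> \<tau> (empirical_measure (\<lambda>i. X i \<omega>) n) \<alpha>)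
            (min_sets \<F> \<tau> \<mu> \<alpha>)) \<longlonglongrightarrow> 0"
proof -
  interpret M: prob_space \<mu> by fact
  note stable = \<open>stable_class \<F>\<close> and cont = \<open>isCont (min_size \<F> \<tau> \<mu>) \<alpha>\<close>
    and fin = assms(6) and alpha = \<open>0 < \<alpha>\<close> \<open>\<alpha> < 1\<close> and dF_lim = assms(13)
  have borel_\<F>: "A \<in> sets borel" if "A \<in> \<F>" for A
    using stable that by (auto simp: stable_class_def intro: borel_closed)
  define \<nu> where "\<nu> \<omega> n = empirical_measure (\<lambda>i. X i \<omega>) n" for \<omega> n
  obtain \<B> :: "'a set set" where \<B>: "countable \<B>" "topological_basis \<B>"
    using ex_countable_basis by blast
  \<comment> \<open>Levels strictly below \<alpha> leave a margin in the mass constraint; the offset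
    2 keeps \<open>\<beta> 0\<close> positive, as the finiteness assumption requires.\<close>
  define \<beta> where "\<beta> j = \<alpha> - \<alpha> / real (j + 2)" for j :: nat
  have \<beta>: "0 < \<beta> j" "\<beta> j < \<alpha>" for j
  proof -
    have "\<alpha> / real (j + 2) < \<alpha>"
      using alpha by (subst pos_divide_less_eq) auto
    then show "0 < \<beta> j" "\<beta> j < \<alpha>"
      using alpha by (auto simp: \<beta>_def)
  qed
  have \<beta>_lim: "\<beta> \<longlonglongrightarrow> \<alpha>"
    unfolding \<beta>_def by real_asymp
  \<comment> \<open>The infimum need not be attained. The slack gives a competitor strictly below
    \<open>t j\<close>, since the infimum is finite.\<close>
  define t where "t j = min_size \<F> \<tau> \<mu> (\<beta> j) + ennreal (1 / real (Suc j))" for j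
  have "\<exists>A\<in>\<F>. 1 - \<beta> j \<le> measure \<mu> A \<and> \<tau> A < t j" for j
  proof -
    have "min_size \<F> \<tau> \<mu> (\<beta> j) < t j"
      using fin[of "\<beta> j"] \<beta>[of j] alpha unfolding t_def
      by (cases "min_size \<F> \<tau> \<mu> (\<beta> j)") (auto simp: ennreal_less_iff simp flip: ennreal_plus)
    then show ?thesis
      unfolding min_size_def INF_less_iff by blast
  qed
  then obtain C where C: "\<And>j. C j \<in> \<F>" "\<And>j. 1 - \<beta> j \<le> measure \<mu> (C j)" "\<And>j. \<tau> (C j) < t j"
    by metis
  have t_lim: "t \<longlonglongrightarrow> min_size \<F> \<tau> \<mu> \<alpha>"
  proof -
    have "(\<lambda>j. ennreal (1 / real (Suc j))) \<longlonglongrightarrow> ennreal 0"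
      by (intro tendsto_ennrealI) real_asymp
    then have "t \<longlonglongrightarrow> min_size \<F> \<tau> \<mu> \<alpha> + ennreal 0"
      unfolding t_def by (intro tendsto_add isCont_tendsto_compose[OF cont] \<beta>_lim)
    then show ?thesis by simp
  qed
  have slln: "AE \<omega> in P. (\<lambda>n. measure (\<nu> \<omega> n) A) \<longlonglongrightarrow> measure \<mu> A" if "A \<in> sets borel" for A
    unfolding \<nu>_def using assms(7-9) that by (rule AE_empirical_measure_tendsto)
  \<comment> \<open>Minimizers depend on the sample and cannot be listed in advance; a countable
    family of fixed sets allows one null set for all of them.\<close>
  define \<D> where "\<D> = Union ` {\<U>. finite \<U> \<and> \<U> \<subseteq> \<B>} \<union> range C"
  have "countable \<D>"
    unfolding \<D>_def using countable_Collect_finite_subset[OF \<B>(1)] by (simp add: conj_commute)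
  moreover have "\<D> \<subseteq> sets borel"
    using topological_basis_open[OF \<B>(2)] borel_\<F> C(1)
    by (auto simp: \<D>_def intro!: borel_open[OF open_Union])
  ultimately have "AE \<omega> in P. \<forall>A\<in>\<D>. (\<lambda>n. measure (\<nu> \<omega> n) A) \<longlonglongrightarrow> measure \<mu> A"
    using slln by (subst AE_ball_countable) auto
  then show ?thesis
    unfolding \<nu>_def[symmetric]
  proof eventually_elim
    case (elim \<omega>)
    show ?case
    proof (rule order_tendstoI)
      fix a :: ennreal assume "0 < a"
      \<comment> \<open>\<open>a\<close> may be infinite; an intermediate value is finite and
        provides a real radius.\<close>
      then obtain \<delta>' where "0 < \<delta>'" "\<delta>' < a"
        using dense by blast
      then obtain \<delta> where \<delta>: "0 < \<delta>" "ennreal \<delta> < a"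
        by (cases \<delta>') auto
      have "\<forall>\<^sub>F n in sequentially. min_sets \<F> \<tau> (\<nu> \<omega> n) \<alpha> \<subseteq> nbhd \<F> dF (min_sets \<F> \<tau> \<mu> \<alpha>) \<delta>"
      proof (rule ccontr)
        assume "\<not> ?thesis"
        then obtain s :: "nat \<Rightarrow> nat" where s: "strict_mono s"
          "\<And>n. \<not> min_sets \<F> \<tau> (\<nu> \<omega> (s n)) \<alpha> \<subseteq> nbhd \<F> dF (min_sets \<F> \<tau> \<mu> \<alpha>) \<delta>"
          using not_eventually_sequentiallyD by blast
        then have "\<exists>A. A \<in> min_sets \<F> \<tau> (\<nu> \<omega> (s n)) \<alpha> \<and> A \<notin> nbhd \<F> dF (min_sets \<F> \<tau> \<mu> \<alpha>) \<delta>" for n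
          by blast
        then obtain A where A: "\<And>n. A n \<in> min_sets \<F> \<tau> (\<nu> \<omega> (s n)) \<alpha>"
          "\<And>n. A n \<notin> nbhd \<F> dF (min_sets \<F> \<tau> \<mu> \<alpha>) \<delta>"
          by metis
        obtain u :: "nat \<Rightarrow> nat" where u: "strict_mono u"
          "\<And>U. U \<in> \<B> \<Longrightarrow> (\<forall>\<^sub>F n in sequentially. A (u n) \<inter> U = {}) \<or>
                    (\<forall>\<^sub>F n in sequentially. A (u n) \<inter> U \<noteq> {})"
          using subseq_eventually_meets_or_misses[OF \<B>(1)] by metis
        have "range (\<lambda>n. A (u n)) \<subseteq> \<F>"
          using min_setsD(1)[OF A(1)] by auto
        \<comment> \<open>The indices \<open>r\<close> need not increase, so \<open>A'\<close> is
          not a subsequence in the usual sense. Limits and eventual properties still transfer, in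
          particular the dichotomy obtained before.\<close>
        with stable obtain r :: "nat \<Rightarrow> nat" where r: "filterlim r at_top sequentially"
          "set_lim (\<lambda>k. A (u (r k))) \<in> \<F>"
          unfolding stable_class_def by meson
        define A' where "A' k = A (u (r k))" for k
        define q where "q k = s (u (r k))" for k
        define B where "B = set_lim A'"
        have q: "filterlim q at_top sequentially"
          unfolding q_def
          by (rule filterlim_compose[OF filterlim_subseq[OF s(1)]],
              rule filterlim_compose[OF filterlim_subseq[OF u(1)]], rule r(1))
        have A': "A' k \<in> min_sets \<F> \<tau> (\<nu> \<omega> (q k)) \<alpha>" "A' k \<in> \<F>" for k
          using A(1) min_setsD(1)[OF A(1)] by (auto simp: A'_def q_def)
        have B: "B \<in> \<F>"
          using r(2) by (simp add: B_def A'_def[abs_def])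
        have lim_q: "(\<lambda>k. measure (\<nu> \<omega> (q k)) D) \<longlonglongrightarrow> measure \<mu> D" if "D \<in> \<D>" for D
          using filterlim_compose[OF bspec[OF elim that] q] .
        have "1 - \<alpha> \<le> measure \<mu> (set_lim A')"
        proof (rule measure_set_lim_ge[OF M.prob_space_axioms \<open>sets \<mu> = sets borel\<close> \<B>])
          show "(\<forall>\<^sub>F n in sequentially. A' n \<inter> U = {}) \<or> (\<forall>\<^sub>F n in sequentially. A' n \<inter> U \<noteq> {})"
            if "U \<in> \<B>" for U
            using u(2)[OF that] eventually_compose_filterlim[OF _ r(1)] unfolding A'_def by blast
          \<comment> \<open>At index 0 there are no sample points and the empirical measure is null,
            hence the passage to \<open>q n\<close> at least 1.\<close>
          show "\<forall>\<^sub>F n in sequentially. prob_space (\<nu> \<omega> (q n))"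
            using eventually_compose_filterlim[OF eventually_ge_at_top[of 1] q]
            by eventually_elim (simp add: \<nu>_def prob_space_empirical_measure)
          show "sets (\<nu> \<omega> (q n)) = sets borel" for n
            by (simp add: \<nu>_def)
          show "(\<lambda>n. measure (\<nu> \<omega> (q n)) (\<Union>\<U>)) \<longlonglongrightarrow> measure \<mu> (\<Union>\<U>)"
            if "finite \<U>" "\<U> \<subseteq> \<B>" for \<U>
            using that by (intro lim_q) (auto simp: \<D>_def)
          show "\<forall>\<^sub>F n in sequentially. 1 - \<alpha> \<le> measure (\<nu> \<omega> (q n)) (A' n)"
            using min_setsD(2)[OF A'(1)] by simp
        qed (use borel_\<F> A'(2) B in \<open>auto simp: B_def\<close>)
        then have \<mu>B: "1 - \<alpha> \<le> measure \<mu> B"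
          by (simp add: B_def)
        \<comment> \<open>The strict margin makes the fixed set \<open>C j\<close> eventually
          admissible for the empirical measure, and minimality of \<open>A' k\<close> compares the
          two sizes.\<close>
        have upper: "limsup (\<lambda>k. \<tau> (A' k)) \<le> t j" for j
        proof (rule Limsup_bounded)
          have "1 - \<alpha> < measure \<mu> (C j)"
            using C(2)[of j] \<beta>[of j] by simp
          then have "\<forall>\<^sub>F k in sequentially. 1 - \<alpha> < measure (\<nu> \<omega> (q k)) (C j)"
            by (intro order_tendstoD(1)[OF lim_q]) (auto simp: \<D>_def)
          then show "\<forall>\<^sub>F k in sequentially. \<tau> (A' k) \<le> t j"
          proof eventually_elim
            case (elim k)
            have "\<tau> (A' k) \<le> \<tau> (C j)"
              using elim by (intro min_setsD(3)[OF A'(1)] C(1)) simp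
            then show ?case using C(3)[of j] by simp
          qed
        qed
        have up: "limsup (\<lambda>k. \<tau> (A' k)) \<le> min_size \<F> \<tau> \<mu> \<alpha>"
          using t_lim by (rule tendsto_lowerbound) (use upper in auto)
        have low: "\<tau> B \<le> liminf (\<lambda>k. \<tau> (A' k))"
          unfolding B_def using A'(2) B
          by (intro size_function_set_lim_le[OF \<open>size_function \<F> \<tau>\<close>]) (auto simp: B_def)
        have le: "liminf (\<lambda>k. \<tau> (A' k)) \<le> limsup (\<lambda>k. \<tau> (A' k))"
          by (rule Liminf_le_Limsup) simp
        have \<tau>B: "\<tau> B \<le> min_size \<F> \<tau> \<mu> \<alpha>"
          using low le up by order
        \<comment> \<open>Admissibility of \<open>B\<close> closes the chain through
          \<open>low\<close>, \<open>le\<close> and \<open>up\<close>: all its terms are equal, so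
          the sizes converge to that of \<open>B\<close>.\<close>
        have "min_size \<F> \<tau> \<mu> \<alpha> \<le> \<tau> B"
          unfolding min_size_def using B \<mu>B by (intro INF_lower) auto
        then have "liminf (\<lambda>k. \<tau> (A' k)) = \<tau> B" "limsup (\<lambda>k. \<tau> (A' k)) = \<tau> B"
          using low le up by order+
        then have "(\<lambda>k. \<tau> (A' k)) \<longlonglongrightarrow> \<tau> B"
          by (intro Liminf_eq_Limsup) auto
        moreover have "\<tau> B < \<infinity>"
          using \<tau>B fin[OF alpha] by (rule le_less_trans)
        ultimately have "(\<lambda>k. dF (A' k) B) \<longlonglongrightarrow> 0"
          unfolding B_def using A'(2) B by (intro dF_lim) (auto simp: B_def)
        then have "\<forall>\<^sub>F k in sequentially. dF (A' k) B < \<delta>"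
          using \<delta>(1) by (rule order_tendstoD(2))
        then obtain k where "dF (A' k) B < \<delta>"
          using eventually_happens'[OF sequentially_bot] by blast
        \<comment> \<open>\<open>B\<close> is a true minimizer, so a single index with
          \<open>A' k\<close> within \<delta> of it contradicts the choice of
          \<open>A\<close>.\<close>
        then have "A' k \<in> nbhd \<F> dF (min_sets \<F> \<tau> \<mu> \<alpha>) \<delta>"
          using min_setsI[OF B \<mu>B \<tau>B] A'(2) by (auto simp: nbhd_def)
        then show False
          using A(2) by (simp add: A'_def)
      qed
      then show "\<forall>\<^sub>F n in sequentially.
          haus_contrast \<F> dF (min_sets \<F> \<tau> (\<nu> \<omega> n) \<alpha>) (min_sets \<F> \<tau> \<mu> \<alpha>) < a"
      proof eventually_elim
        case (elim n)
        then have "haus_contrast \<F> dF (min_sets \<F> \<tau> (\<nu> \<omega> n) \<alpha>) (min_sets \<F> \<tau> \<mu> \<alpha>) \<le> ennreal \<delta>"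
          unfolding haus_contrast_def using \<delta>(1) by (intro INF_lower) auto
        then show ?case using \<delta>(2) by (rule le_less_trans)
      qed
    qed simp
  qed
qed

end
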